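(* Let $p:\mathbb R\to[0,\infty)$ be a continuous density of a probability distribution and $F(x)=\int_{-\infty}^x p(y)\,dy$ its cumulative distribution function. Let $\pi_N=\{x_k^N: k=0,\dots,k_N\}$, $N\ge1$, with $x_0^N<x_1^N<\dots<x_{k_N}^N$, be a sequence of partitions such that $x_0^N\to-\infty$, $x_{k_N}^N\to+\infty$ and $|\pi_N|=\max_{1\le k\le k_N}(x_k^N-x_{k-1}^N)\to0$ as $N\to\infty$. Put $\Delta F_k^N=F(x_k^N)-F(x_{k-1}^N)$. Then $$\mathcal H_{SH}^N:=-\sum_{k=1}^{k_N}\Delta F_k^N\log\Delta F_k^N-F(x_0^N)\log F(x_0^N)-\left(1-F(x_{k_N}^N)\right)\log\left(1-F(x_{k_N}^N)\right)\to+\infty\quad\text{as }N\to\infty,$$ where $\Delta F_k^N\log\Delta F_k^N$ is taken to be $0$ if $\Delta F_k^N=0$, and similarly for the terms involving $F(x_0^N)$ and $1-F(x_{k_N}^N)$.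
   Context: $\log$ is the natural logarithm. $\mathcal H_{SH}^N$ is the Shannon entropy of the discretized distribution. *)

theory Defs
  imports "HOL-Probability.Probability"
begin

definition cdf_of_density :: "(real \<Rightarrow> real) \<Rightarrow> real \<Rightarrow> real" where
  "cdf_of_density p x = (LBINT y:{..x}. p y)"

text \<open>
  A finite partition is given by its points \<open>x 0 < x 1 < \<dots> < x n\<close>; the values of \<open>x\<close>
  beyond \<open>n\<close> are irrelevant. There is at least one cell, so the maximum defining the mesh is
  taken over a nonempty set.
\<close>

definition partition_points :: "(nat \<Rightarrow> real) \<Rightarrow> nat \<Rightarrow> bool" where
  "partition_points x n \<longleftrightarrow> 1 \<le> n \<and> (\<forall>k\<in>{1..n}. x (k - 1) < x k)"

definition mesh :: "(nat \<Rightarrow> real) \<Rightarrow> nat \<Rightarrow> real" where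
  "mesh x n = (MAX k\<in>{1..n}. x k - x (k - 1))"

definition xlogx :: "real \<Rightarrow> real" where
  "xlogx t = (if t = 0 then 0 else t * ln t)"

text \<open>
  Shannon entropy of the distribution with distribution function \<open>F\<close>, discretized to the cells
  \<open>(x (k - 1), x k]\<close> for \<open>1 \<le> k \<le> n\<close> and the two unbounded end cells.
\<close>

definition shannon_entropy :: "(real \<Rightarrow> real) \<Rightarrow> (nat \<Rightarrow> real) \<Rightarrow> nat \<Rightarrow> real" where
  "shannon_entropy F x n =
     - (\<Sum>k=1..n. xlogx (F (x k) - F (x (k - 1)))) - xlogx (F (x 0)) - xlogx (1 - F (x n))"

end

theory Submission
  imports Defs
begin

text \<open>
  The numbers whose entropy is taken are the masses that the distribution gives to the cells of a
  partition of the line, so they are nonnegative and add up to \<open>1\<close>. If each of them is at most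
  \<open>e\<close>, then \<open>- t ln t \<ge> - t ln e\<close> for each mass \<open>t\<close>, and summing gives an entropy of at
  least \<open>- ln e\<close> (\<open>shannon_entropy_ge\<close>). It remains to see that the largest mass tends to
  \<open>0\<close>. For the two unbounded cells this is the behaviour of a distribution function at
  \<open>\<plusminus>\<infinity>\<close>. For the bounded cells it follows from the uniform continuity of the distribution
  function (\<open>uniformly_continuous_cdf\<close>), because the mesh tends to \<open>0\<close>. The
  distribution function is continuous because a distribution with a density has no atoms.
\<close>

lemma xlogx_le:
  assumes "0 \<le> t" "t \<le> e"
  shows "xlogx t \<le> t * ln e"
  using assms by (auto simp: xlogx_def intro!: mult_left_mono)

text \<open>
  The masses telescope to \<open>1\<close>, so the entropy is a weighted average of the numbers
  \<open>- ln t\<close>, each of which is at least \<open>- ln e\<close>.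
\<close>

lemma shannon_entropy_ge:
  assumes "0 \<le> F (x 0)" "F (x 0) \<le> e"
    and "F (x n) \<le> 1" "1 - F (x n) \<le> e"
    and "\<And>k. k \<in> {1..n} \<Longrightarrow> F (x (k - 1)) \<le> F (x k)"
    and "\<And>k. k \<in> {1..n} \<Longrightarrow> F (x k) - F (x (k - 1)) \<le> e"
  shows "- ln e \<le> shannon_entropy F x n"
proof -
  have telescope: "(\<Sum>k=1..n. F (x k) - F (x (k - 1))) = F (x n) - F (x 0)"
    by (induction n) auto
  have "(\<Sum>k=1..n. xlogx (F (x k) - F (x (k - 1))))
      \<le> (\<Sum>k=1..n. (F (x k) - F (x (k - 1))) * ln e)"
    using assms by (intro sum_mono xlogx_le) auto
  also have "\<dots> = (F (x n) - F (x 0)) * ln e"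
    by (simp only: telescope flip: sum_distrib_right)
  finally have "(\<Sum>k=1..n. xlogx (F (x k) - F (x (k - 1)))) \<le> (F (x n) - F (x 0)) * ln e" .
  moreover have "xlogx (F (x 0)) \<le> F (x 0) * ln e"
    using assms by (intro xlogx_le) auto
  moreover have "xlogx (1 - F (x n)) \<le> (1 - F (x n)) * ln e"
    using assms by (intro xlogx_le) auto
  ultimately show ?thesis
    by (simp add: shannon_entropy_def algebra_simps)
qed

lemma diff_le_mesh: "k \<in> {1..n} \<Longrightarrow> x k - x (k - 1) \<le> mesh x n"
  unfolding mesh_def by (intro Max_ge) auto

text \<open>
  On a compact interval continuity is uniform, and outside a large one there is hardly any
  increase left, since the distribution function is monotone with finite limits at
  \<open>\<plusminus>\<infinity>\<close>.
\<close>

lemma (in real_distribution) uniformly_continuous_cdf: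
  assumes "\<And>a. measure M {a} = 0"
  shows "uniformly_continuous_on UNIV (cdf M)"
proof -
  have small_increment: "\<exists>d>0. \<forall>a b. a \<le> b \<longrightarrow> b - a < d \<longrightarrow> cdf M b - cdf M a < e"
    if e: "e > 0" for e
  proof -
    have "\<forall>\<^sub>F a in at_bot. cdf M a < e"
      using cdf_lim_at_bot e by (rule order_tendstoD)
    then obtain l where l: "cdf M l < e"
      using eventually_happens trivial_limit_at_bot_linorder by blast
    have "\<forall>\<^sub>F a in at_top. cdf M a > 1 - e"
      using cdf_lim_at_top_prob by (rule order_tendstoD) (use e in simp)
    then obtain u where u: "cdf M u > 1 - e"
      using eventually_happens trivial_limit_at_top_linorder by blast
    \<comment> \<open>Enlarging the interval by \<open>1\<close> makes every interval of length below \<open>1\<close> lie in it,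
        or to the left of \<open>l\<close>, or to the right of \<open>u\<close>.\<close>
    let ?I = "{l - 1..u + 1}"
    have "continuous_on ?I (cdf M)"
      using assms by (intro continuous_at_imp_continuous_on) (simp add: isCont_cdf)
    then have "uniformly_continuous_on ?I (cdf M)"
      by (simp add: compact_uniformly_continuous)
    then obtain d where "d > 0"
      and d: "\<And>a b. a \<in> ?I \<Longrightarrow> b \<in> ?I \<Longrightarrow> dist b a < d \<Longrightarrow> dist (cdf M b) (cdf M a) < e"
      using e unfolding uniformly_continuous_on_def by meson
    have "cdf M b - cdf M a < e" if ab: "a \<le> b" "b - a < min d 1" for a b
    proof -
      consider "a \<in> ?I \<and> b \<in> ?I" | "b \<le> l" | "u \<le> a"
        using ab by fastforce
      then show ?thesis
      proof cases
        case 1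
        then show ?thesis using d[of a b] ab by (auto simp: dist_real_def)
      next
        case 2
        then show ?thesis using cdf_nondecreasing[of b l] cdf_nonneg[of a] l by linarith
      next
        case 3
        then show ?thesis using cdf_nondecreasing[of u a] cdf_bounded_prob[of b] u by linarith
      qed
    qed
    then show ?thesis
      using \<open>d > 0\<close> by (intro exI[of _ "min d 1"]) auto
  qed
  show ?thesis
    unfolding uniformly_continuous_on_def
  proof (intro allI impI)
    fix e :: real assume "e > 0"
    then obtain d where "d > 0"
      and d: "\<And>a b. a \<le> b \<Longrightarrow> b - a < d \<Longrightarrow> cdf M b - cdf M a < e"
      using small_increment by blast
    have "dist (cdf M b) (cdf M a) < e" if "dist b a < d" for a b
      using that d[of a b] d[of b a] cdf_nondecreasing[of a b] cdf_nondecreasing[of b a]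
      by (cases "a \<le> b") (auto simp: dist_real_def abs_if split: if_splits)
    then show "\<exists>d>0. \<forall>a\<in>UNIV. \<forall>b\<in>UNIV. dist b a < d \<longrightarrow> dist (cdf M b) (cdf M a) < e"
      using \<open>d > 0\<close> by blast
  qed
qed

text \<open>
  For every \<open>e > 0\<close> all cells eventually have mass at most \<open>e\<close>, and \<open>- ln e\<close> exceeds any
  given bound when \<open>e\<close> is small.
\<close>

lemma (in real_distribution) shannon_entropy_cdf_at_top:
  fixes x :: "nat \<Rightarrow> nat \<Rightarrow> real" and K :: "nat \<Rightarrow> nat"
  assumes atomless: "\<And>a. measure M {a} = 0"
    and partition: "\<forall>\<^sub>F N in sequentially. partition_points (x N) (K N)"
    and left: "filterlim (\<lambda>N. x N 0) at_bot sequentially"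
    and right: "filterlim (\<lambda>N. x N (K N)) at_top sequentially"
    and mesh: "(\<lambda>N. mesh (x N) (K N)) \<longlonglongrightarrow> 0"
  shows "filterlim (\<lambda>N. shannon_entropy (cdf M) (x N) (K N)) at_top sequentially"
  unfolding filterlim_at_top
proof
  fix Z :: real
  \<comment> \<open>chosen so that \<open>- ln e = Z\<close>\<close>
  define e where "e = exp (- Z)"
  have "e > 0" by (simp add: e_def)
  then obtain d where "d > 0"
    and d: "\<And>a b. dist b a < d \<Longrightarrow> dist (cdf M b) (cdf M a) < e"
    using uniformly_continuous_cdf[OF atomless] unfolding uniformly_continuous_on_def by blast
  have "\<forall>\<^sub>F N in sequentially. cdf M (x N 0) < e"
    using filterlim_compose[OF cdf_lim_at_bot left] \<open>e > 0\<close> by (rule order_tendstoD)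
  moreover have "\<forall>\<^sub>F N in sequentially. cdf M (x N (K N)) > 1 - e"
    using filterlim_compose[OF cdf_lim_at_top_prob right]
    by (rule order_tendstoD) (use \<open>e > 0\<close> in simp)
  moreover have "\<forall>\<^sub>F N in sequentially. mesh (x N) (K N) < d"
    using mesh \<open>d > 0\<close> by (rule order_tendstoD)
  ultimately show "\<forall>\<^sub>F N in sequentially. Z \<le> shannon_entropy (cdf M) (x N) (K N)"
    using partition
  proof eventually_elim
    case (elim N)
    have cell: "x N (k - 1) < x N k \<and> x N k - x N (k - 1) < d" if "k \<in> {1..K N}" for k
      using elim(3,4) that diff_le_mesh[OF that, of "x N"] by (auto simp: partition_points_def)
    have "- ln e \<le> shannon_entropy (cdf M) (x N) (K N)"
    proof (rule shannon_entropy_ge)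
      fix k assume "k \<in> {1..K N}"
      note k = cell[OF this]
      show "cdf M (x N (k - 1)) \<le> cdf M (x N k)"
        using k by (intro cdf_nondecreasing) simp
      show "cdf M (x N k) - cdf M (x N (k - 1)) \<le> e"
        using d[of "x N k" "x N (k - 1)"] k by (auto simp: dist_real_def)
    qed (use elim(1,2) cdf_nonneg cdf_bounded_prob in auto)
    then show ?case by (simp add: e_def)
  qed
qed

lemma cdf_density:
  assumes [measurable]: "p \<in> borel_measurable borel" and "\<And>y. 0 \<le> p y"
    and "prob_space (density lborel (\<lambda>y. ennreal (p y)))"
  shows "cdf (density lborel (\<lambda>y. ennreal (p y))) = cdf_of_density p"
proof
  fix x
  let ?M = "density lborel (\<lambda>y. ennreal (p y))"
  interpret prob_space ?M by fact
  have "cdf ?M x = (\<integral>y. indicator {..x} y \<partial>?M)"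
    by (simp add: cdf_def)
  also have "\<dots> = (\<integral>y. p y *\<^sub>R indicator {..x} y \<partial>lborel)"
    using assms by (intro integral_density) auto
  also have "\<dots> = cdf_of_density p x"
    by (simp add: cdf_of_density_def set_lebesgue_integral_def mult.commute)
  finally show "cdf ?M x = cdf_of_density p x" .
qed

theorem lemma1:
  fixes p :: "real \<Rightarrow> real" and x :: "nat \<Rightarrow> nat \<Rightarrow> real" and K :: "nat \<Rightarrow> nat"
  assumes "\<And>y. 0 \<le> p y"
    and "continuous_on UNIV p"
    and "prob_space (density lborel (\<lambda>y. ennreal (p y)))"
    and "\<And>N. 1 \<le> N \<Longrightarrow> partition_points (x N) (K N)"
    and "filterlim (\<lambda>N. x N 0) at_bot sequentially"
    and "filterlim (\<lambda>N. x N (K N)) at_top sequentially"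
    and "(\<lambda>N. mesh (x N) (K N)) \<longlonglongrightarrow> 0"
  shows "filterlim (\<lambda>N. shannon_entropy (cdf_of_density p) (x N) (K N)) at_top sequentially"
proof -
  let ?M = "density lborel (\<lambda>y. ennreal (p y))"
  have [measurable]: "p \<in> borel_measurable borel"
    using assms(2) by (rule borel_measurable_continuous_onI)
  interpret real_distribution ?M
    using assms(3) by (simp add: real_distribution_def real_distribution_axioms_def)
  have "AE y in lborel. y \<in> {a} \<longrightarrow> ennreal (p y) = 0" for a
    using AE_lborel_singleton[of a] by eventually_elim simp
  then have "{a} \<in> null_sets ?M" for a
    by (simp add: null_sets_density_iff)
  then have "measure ?M {a} = 0" for a
    by (simp add: measure_def null_setsD1)
  moreover have "\<forall>\<^sub>F N in sequentially. partition_points (x N) (K N)"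
    using assms(4) by (auto simp: eventually_sequentially)
  ultimately have "filterlim (\<lambda>N. shannon_entropy (cdf ?M) (x N) (K N)) at_top sequentially"
    using assms(5-7) by (rule shannon_entropy_cdf_at_top)
  then show ?thesis
    by (simp add: cdf_density assms(1,3))
qed

end
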